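(* Let $u^{\rm true}\in\mathcal{X}$ and let $y_m=\ell_m^o(u^{\rm true})$ for $m=1,\ldots,M$. Suppose that $\beta_{N,M}>0$ and that the $M$-dimensional space $\mathcal{U}_M\subset\mathcal{X}$ satisfies the unisolvency condition $$\psi\in\mathcal{U}_M,\ \ \ell_m^o(\psi)=0,\ m=1,\ldots,M \iff \psi\equiv 0 .$$ Let $u_{\xi=0}^{\rm opt}=z^{\rm opt}+\eta^{\rm opt}$, where $(z^{\rm opt},\eta^{\rm opt})$ is the solution to $$\inf_{(z,\eta)\in\mathcal{Z}_N\times\mathcal{U}}\ \|\eta\|\quad\text{subject to}\quad \ell_m^o(z+\eta)=y_m,\ \ m=1,\ldots,M .$$ Then $$|||u^{\rm true}-u_{\xi=0}^{\rm opt}|||\ \le\ \frac{1}{\beta_{N,M}}\ \inf_{z\in\mathcal{Z}_N}\ \inf_{q\in\mathcal{U}_M\cap\mathcal{Z}_N^{\perp,|||\cdot|||}}\ |||u^{\rm true}-z-q|||$$ and $$\|u^{\rm true}-u_{\xi=0}^{\rm opt}\|\ \le\ \frac{\sqrt{4+6\,\|\mathcal{I}_M\|_{\mathcal{L}(\mathcal{X})}^2}}{\beta_{N,M}}\ \inf_{z\in\mathcal{Z}_N}\ \inf_{q\in\mathcal{U}_M\cap\mathcal{Z}_N^{\perp,|||\cdot|||}}\ \|u^{\rm true}-z-q\| .$$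
   Context: $\mathcal{X}$ is a real Hilbert space (of functions on a Lipschitz domain $\Omega\subset\mathbb{R}^d$) with inner product $(\cdot,\cdot)$ and induced norm $\|\cdot\|=\sqrt{(\cdot,\cdot)}$; $\mathcal{X}'$ is its dual. $\ell_1^o,\ldots,\ell_M^o\in\mathcal{X}'$ are observation functionals, with Riesz representers $R_{\mathcal{X}}\ell_m^o\in\mathcal{X}$, i.e. $(R_{\mathcal{X}}\ell_m^o,f)=\ell_m^o(f)$ for all $f\in\mathcal{X}$. $\mathcal{Z}_N\subset\mathcal{X}$ is an $N$-dimensional linear subspace (background space) and $\mathcal{U}_M\subset\mathcal{X}$ is an $M$-dimensional linear subspace (update space). The search space $\mathcal{U}$ is one of the following: either $\mathcal{U}=\mathcal{U}_M$ (user-defined update), or $\mathcal{U}=\mathcal{X}$, in which case $\mathcal{U}_M={\rm span}\{R_{\mathcal{X}}\ell_m^o\}_{m=1}^M$ (variational update). When $\mathcal{U}_M$ satisfies the unisolvency condition, the interpolation operator $\mathcal{I}_M:\mathcal{X}\to\mathcal{U}_M$ is defined by $\ell_m^o(\mathcal{I}_M(u))=\ell_m^o(u)$ for all $u\in\mathcal{X}$, $m=1,\ldots,M$, and $\|\mathcal{I}_M\|_{\mathcal{L}(\mathcal{X})}=\sup_{v\in\mathcal{X}\setminus\{0\}}\|\mathcal{I}_M(v)\|/\|v\|$. Define the symmetric bilinear form (an inner product on $\mathcal{X}$) $$((u,v))=(u-\mathcal{I}_M(u),v-\mathcal{I}_M(v))+(\mathcal{I}_M(u),\mathcal{I}_M(v)),\qquad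 |||u|||=\sqrt{((u,u))}.$$ $\mathcal{Z}_N^{\perp,|||\cdot|||}=\{v\in\mathcal{X}:((v,z))=0\ \forall z\in\mathcal{Z}_N\}$. The inf-sup constant is $$\beta_{N,M}=\inf_{z\in\mathcal{Z}_N\setminus\{0\}}\ \sup_{q\in\mathcal{U}_M\setminus\{0\}}\frac{((z,q))}{|||z|||\,|||q|||}.$$ *)

theory Defs
  imports "HOL-Analysis.Analysis"
begin

text \<open>The library's \<^const>\<open>dim\<close> is also 0 on infinite-dimensional spaces, so finite
  dimensionality is stated through an explicit finite basis.\<close>

definition finite_dim_subspace :: "nat \<Rightarrow> 'a::real_vector set \<Rightarrow> bool" where
  "finite_dim_subspace n V \<longleftrightarrow> (\<exists>B. finite B \<and> independent B \<and> card B = n \<and> span B = V)"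

definition riesz :: "('a::{real_inner,complete_space} \<Rightarrow>\<^sub>L real) \<Rightarrow> 'a" where
  "riesz l = (THE r. \<forall>f. r \<bullet> f = blinfun_apply l f)"

definition unisolvent :: "(nat \<Rightarrow> 'a::real_inner \<Rightarrow>\<^sub>L real) \<Rightarrow> nat \<Rightarrow> 'a set \<Rightarrow> bool" where
  "unisolvent l M U \<longleftrightarrow>
     (\<forall>\<psi>. (\<psi> \<in> U \<and> (\<forall>m\<in>{1..M}. blinfun_apply (l m) \<psi> = 0)) \<longleftrightarrow> \<psi> = 0)"

text \<open>The value is determined when \<open>U\<close> is \<open>M\<close>-dimensional and unisolvent.\<close>

definition interp :: "(nat \<Rightarrow> 'a::real_inner \<Rightarrow>\<^sub>L real) \<Rightarrow> nat \<Rightarrow> 'a set \<Rightarrow> 'a \<Rightarrow> 'a" where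
  "interp l M U u =
     (THE w. w \<in> U \<and> (\<forall>m\<in>{1..M}. blinfun_apply (l m) w = blinfun_apply (l m) u))"

text \<open>In the following definitions \<open>I\<close> is the interpolation operator.\<close>

definition tinner :: "('a::real_inner \<Rightarrow> 'a) \<Rightarrow> 'a \<Rightarrow> 'a \<Rightarrow> real" where
  "tinner I u v = (u - I u) \<bullet> (v - I v) + I u \<bullet> I v"

definition tnorm :: "('a::real_inner \<Rightarrow> 'a) \<Rightarrow> 'a \<Rightarrow> real" where
  "tnorm I u = sqrt (tinner I u u)"

definition tperp :: "('a::real_inner \<Rightarrow> 'a) \<Rightarrow> 'a set \<Rightarrow> 'a set" where
  "tperp I Z = {v. \<forall>z\<in>Z. tinner I v z = 0}"

definition infsup :: "('a::real_inner \<Rightarrow> 'a) \<Rightarrow> 'a set \<Rightarrow> 'a set \<Rightarrow> real" where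
  "infsup I Z U =
     (INF z\<in>Z - {0}. SUP q\<in>U - {0}. tinner I z q / (tnorm I z * tnorm I q))"

definition feasible ::
  "(nat \<Rightarrow> 'a::real_inner \<Rightarrow>\<^sub>L real) \<Rightarrow> nat \<Rightarrow> (nat \<Rightarrow> real) \<Rightarrow> 'a set \<Rightarrow> 'a set \<Rightarrow> 'a \<times> 'a \<Rightarrow> bool" where
  "feasible l M y Z U = (\<lambda>(z, \<eta>). z \<in> Z \<and> \<eta> \<in> U \<and> (\<forall>m\<in>{1..M}. blinfun_apply (l m) (z + \<eta>) = y m))"

end

theory Submission
  imports Defs
begin

text \<open>The operator \<open>I\<close> is a bounded projection onto \<open>UM\<close> whose kernel is \<open>tinner\<close>-orthogonal to \<open>UM\<close>, and
  \<open>norm (I z) \<ge> \<beta> * tnorm I z\<close> on \<open>Z\<close>. In both settings optimality forces \<open>\<eta>opt\<close> into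
  \<open>UM \<inter> tperp I Z\<close>. Hence, for competitors \<open>z\<close> and \<open>q\<close>, the residual \<open>utrue - z - q\<close> is
  \<open>e + \<zeta> + \<delta>\<close> with the error \<open>e\<close> in the kernel of \<open>I\<close>, \<open>\<zeta> \<in> Z\<close>, and \<open>\<delta>\<close> orthogonal to both.
  Dropping \<open>\<delta>\<close>, it remains to bound \<open>e\<close> by \<open>e + \<zeta>\<close>, which the angle condition between \<open>Z\<close> and
  \<open>UM\<close> does with constant \<open>1 / \<beta>\<close>. On the kernel of \<open>I\<close> the two norms agree.\<close>

section \<open>Riesz representation by energy minimisation\<close>

lemma linear_coeff_eq_0_if_quadratic_nonneg:
  fixes a b :: real
  assumes "\<And>t. 0 \<le> t\<^sup>2 * a + 2 * t * b"
  shows "b = 0"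
proof -
  \<comment> \<open>The parabola is tested at \<open>t = - b / c\<close>. The added 1 keeps
    \<open>c\<close> positive even if \<open>a = 0\<close>, and replacing \<open>a\<close> by
    \<open>c\<close> leaves exactly \<open>- (b\<^sup>2 / c)\<close>.\<close>
  define c where "c = \<bar>a\<bar> + 1"
  have c: "c > 0" "a \<le> c" by (auto simp: c_def)
  have "0 \<le> (- b / c)\<^sup>2 * a + 2 * (- b / c) * b" by (rule assms)
  also have "\<dots> \<le> (- b / c)\<^sup>2 * c + 2 * (- b / c) * b"
    using c by (intro add_right_mono mult_left_mono) auto
  also have "\<dots> = - (b\<^sup>2 / c)"
    using c by (simp add: field_simps power2_eq_square)
  finally have "b\<^sup>2 / c \<le> 0" by simp
  with c show ?thesis by (simp add: divide_le_0_iff)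
qed

text \<open>Up to an additive constant, the energy \<open>J\<close> is the squared distance to the
  sought representer, so the representer is found as its minimiser. Completeness supplies the
  minimiser as the limit of a minimising sequence.\<close>

lemma riesz_representation:
  fixes l :: "'a::{real_inner,complete_space} \<Rightarrow>\<^sub>L real"
  shows "\<exists>r. \<forall>f. r \<bullet> f = blinfun_apply l f"
proof -
  define J where "J x = x \<bullet> x - 2 * blinfun_apply l x" for x
  define d where "d = (INF x. J x)"
  have lower: "- (norm l)\<^sup>2 \<le> J x" for x
  proof -
    have "blinfun_apply l x \<le> norm l * norm x"
      using norm_blinfun[of l x] by simp
    moreover have "0 \<le> (norm x - norm l)\<^sup>2" by simp
    ultimately show ?thesis
      by (simp add: J_def power2_diff power2_norm_eq_inner algebra_simps)
  qed
  then have bdd: "bdd_below (range J)" by (auto intro!: bdd_belowI)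
  have d_le: "d \<le> J x" for x
    unfolding d_def by (rule cINF_lower[OF bdd]) simp
  have "\<exists>x. J x < d + e" if "e > 0" for e
    using that cINF_less_iff[OF _ bdd, of "d + e"] by (auto simp: d_def)
  then have "\<exists>X. \<forall>n. J (X n) < d + 1 / real (Suc n)"
    by (intro choice) auto
  then obtain X where X: "\<And>n. J (X n) < d + 1 / real (Suc n)" by blast
  \<comment> \<open>Parallelogram law: the linear terms cancel, and the midpoint has energy at least
    \<open>d\<close>.\<close>
  have dist_le: "(dist x y)\<^sup>2 \<le> 2 * J x + 2 * J y - 4 * d" for x y
  proof -
    have "(dist x y)\<^sup>2 = 2 * J x + 2 * J y - 4 * J ((1/2) *\<^sub>R (x + y))"
      by (simp add: J_def dist_norm power2_norm_eq_inner blinfun.bilinear_simps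
          inner_add_left inner_add_right inner_diff_left inner_diff_right inner_commute algebra_simps)
    then show ?thesis using d_le[of "(1/2) *\<^sub>R (x + y)"] by simp
  qed
  have "Cauchy X"
  proof (rule metric_CauchyI)
    fix e :: real assume "e > 0"
    \<comment> \<open>From index \<open>k\<close> on, energies lie within
      \<open>e\<^sup>2 / 4\<close> of \<open>d\<close>; the coefficients 2 and 2 in
      \<open>dist_le\<close> then add up to \<open>e\<^sup>2\<close>.\<close>
    then obtain k where k: "4 / e\<^sup>2 < real k" using reals_Archimedean2 by blast
    with \<open>e > 0\<close> have k0: "0 < real k" by (meson divide_pos_pos less_trans zero_less_numeral zero_less_power)
    have near: "J (X n) < d + e\<^sup>2 / 4" if "n \<ge> k" for n
    proof -
      have "1 / real (Suc n) \<le> 1 / real k"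
        using that k0 by (intro divide_left_mono) auto
      moreover have "1 / real k < e\<^sup>2 / 4"
        using k k0 \<open>e > 0\<close> by (simp add: field_simps)
      ultimately show ?thesis using X[of n] by linarith
    qed
    have "dist (X m) (X n) < e" if "m \<ge> k" "n \<ge> k" for m n
    proof (rule power2_less_imp_less)
      show "(dist (X m) (X n))\<^sup>2 < e\<^sup>2"
        using dist_le[of "X m" "X n"] near[OF that(1)] near[OF that(2)] by linarith
    qed (use \<open>e > 0\<close> in simp)
    then show "\<exists>k. \<forall>m\<ge>k. \<forall>n\<ge>k. dist (X m) (X n) < e" by blast
  qed
  then obtain r where r: "X \<longlonglongrightarrow> r"
    using Cauchy_convergent_iff convergent_def by blast
  have "(\<lambda>n. J (X n)) \<longlonglongrightarrow> J r"
    unfolding J_def by (intro tendsto_intros r)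
  moreover have "(\<lambda>n. d + 1 / real (Suc n)) \<longlonglongrightarrow> d + 0"
    by (intro tendsto_intros lim_1_over_n[THEN LIMSEQ_Suc])
  ultimately have "J r \<le> d + 0"
    by (rule LIMSEQ_le) (use X less_imp_le in blast)
  then have min: "J r \<le> J x" for x using d_le[of x] by simp
  \<comment> \<open>First variation: the quadratic in \<open>t\<close> is the increment
    \<open>J (r + t *\<^sub>R f) - J r\<close>, nonnegative by minimality.\<close>
  have "r \<bullet> f - blinfun_apply l f = 0" for f
  proof (rule linear_coeff_eq_0_if_quadratic_nonneg)
    fix t :: real
    show "0 \<le> t\<^sup>2 * (f \<bullet> f) + 2 * t * (r \<bullet> f - blinfun_apply l f)"
      using min[of "r + t *\<^sub>R f"]
      by (simp add: J_def blinfun.bilinear_simps inner_add_left inner_add_right inner_commute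
          power2_eq_square algebra_simps)
  qed
  then show ?thesis by auto
qed

lemma riesz_inner:
  fixes l :: "'a::{real_inner,complete_space} \<Rightarrow>\<^sub>L real"
  shows "riesz l \<bullet> f = blinfun_apply l f"
proof -
  obtain r where r: "\<And>f. r \<bullet> f = blinfun_apply l f" using riesz_representation by blast
  have "\<forall>f. riesz l \<bullet> f = blinfun_apply l f"
    unfolding riesz_def
  proof (rule theI)
    show "\<forall>f. r \<bullet> f = blinfun_apply l f" using r by blast
    fix s assume "\<forall>f. s \<bullet> f = blinfun_apply l f"
    then have "\<forall>f. s \<bullet> f = r \<bullet> f" using r by simp
    then show "s = r" by (simp only: vector_eq_rdot)
  qed
  then show ?thesis by blast
qed

section \<open>Unisolvent interpolation\<close>

text \<open>Each functional costs at most one dimension: if \<open>g a\<close> is nonzero at some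
  \<open>t\<close> in the kernel reached so far, subtracting a multiple of \<open>t\<close> moves
  any vector of that kernel into the kernel of \<open>g a\<close>. The spanning-set form makes sense
  for \<open>V\<close> of any dimension.\<close>

lemma subspace_subset_span_common_kernel:
  fixes g :: "'i \<Rightarrow> 'a::real_vector \<Rightarrow> real"
  assumes "finite A" "\<And>i. i \<in> A \<Longrightarrow> linear (g i)" "subspace V"
  shows "\<exists>T. finite T \<and> card T \<le> card A \<and> V \<subseteq> span (T \<union> {v \<in> V. \<forall>i\<in>A. g i v = 0})"
  using assms(1,2)
proof (induction A)
  case empty
  then show ?case by (auto intro!: exI[of _ "{}"] span_base)
next
  case (insert a A)
  define W where "W = {v \<in> V. \<forall>i\<in>A. g i v = 0}"
  define W' where "W' = {v \<in> V. \<forall>i\<in>insert a A. g i v = 0}"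
  obtain T where T: "finite T" "card T \<le> card A" "V \<subseteq> span (T \<union> W)"
    using insert.IH[OF insert.prems] unfolding W_def by auto
  have lin: "linear (g i)" if "i \<in> insert a A" for i using insert.prems that by blast
  show ?case
  proof (cases "\<forall>w\<in>W. g a w = 0")
    case True
    then have "W = W'" by (auto simp: W_def W'_def)
    then show ?thesis using T insert.hyps W'_def by (intro exI[of _ T]) auto
  next
    case False
    then obtain t where t: "t \<in> W" "g a t \<noteq> 0" by blast
    have "W \<subseteq> span (insert t T \<union> W')"
    proof
      fix w assume w: "w \<in> W"
      define c where "c = g a w / g a t"
      have "w - c *\<^sub>R t \<in> W'"
        using w t lin assms(3)
        by (auto simp: W_def W'_def c_def linear_diff linear_scale subspace_diff subspace_scale)
      then have "(w - c *\<^sub>R t) + c *\<^sub>R t \<in> span (insert t T \<union> W')"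
        by (intro span_add span_scale span_base) auto
      then show "w \<in> span (insert t T \<union> W')" by simp
    qed
    then have "span (T \<union> W) \<subseteq> span (insert t T \<union> W')"
      by (intro span_minimal) (auto intro: span_base)
    moreover have "card (insert t T) \<le> card (insert a A)"
      using T insert.hyps by (simp add: card_insert_if)
    ultimately show ?thesis
      using T unfolding W'_def by (intro exI[of _ "insert t T"]) auto
  qed
qed

text \<open>Otherwise at most \<open>card A\<close> vectors would span a space containing
  \<open>n\<close> independent ones. With \<open>A\<close> empty this also yields nonzero vectors in
  spaces of positive dimension.\<close>

lemma ex_nonzero_common_kernel:
  fixes g :: "'i \<Rightarrow> 'a::real_vector \<Rightarrow> real"
  assumes "finite A" "\<And>i. i \<in> A \<Longrightarrow> linear (g i)"
    and "finite_dim_subspace n V" "card A < n"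
  shows "\<exists>v\<in>V. v \<noteq> 0 \<and> (\<forall>i\<in>A. g i v = 0)"
proof (rule ccontr)
  assume no: "\<not> ?thesis"
  obtain B where B: "finite B" "independent B" "card B = n" "span B = V"
    using assms(3) unfolding finite_dim_subspace_def by blast
  obtain T where T: "finite T" "card T \<le> card A" "V \<subseteq> span (T \<union> {v \<in> V. \<forall>i\<in>A. g i v = 0})"
    using subspace_subset_span_common_kernel[where g = g, OF assms(1,2) subspace_span[of B]] B(4) by auto
  have "T \<union> {v \<in> V. \<forall>i\<in>A. g i v = 0} \<subseteq> insert 0 T" using no by blast
  then have "V \<subseteq> span (insert 0 T)" by (rule order_trans[OF T(3) span_mono])
  then have "V \<subseteq> span T" by (simp only: span_insert_0)
  then have "B \<subseteq> span T" using B(4) span_superset by blast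
  then have "card B \<le> card T" using independent_span_bound[OF T(1) B(2)] by simp
  then show False using B(3) T(2) assms(4) by simp
qed

text \<open>Dropping the \<open>m\<close>-th functional leaves fewer functionals than dimensions, so
  some nonzero \<open>v\<close> is annihilated by all the others. Unisolvency forces
  \<open>l m\<close> to be nonzero at \<open>v\<close>, which can then be normalised.\<close>

lemma ex_dual_basis:
  fixes l :: "nat \<Rightarrow> 'a::real_inner \<Rightarrow>\<^sub>L real"
  assumes "finite_dim_subspace M V" "unisolvent l M V"
  shows "\<exists>\<psi>. \<forall>m\<in>{1..M}. \<psi> m \<in> V \<and> (\<forall>k\<in>{1..M}. blinfun_apply (l k) (\<psi> m) = (if k = m then 1 else 0))"
proof (intro bchoice ballI)
  fix m assume m: "m \<in> {1..M}"
  have V: "subspace V" using assms(1) unfolding finite_dim_subspace_def by auto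
  have "\<exists>v\<in>V. v \<noteq> 0 \<and> (\<forall>k\<in>{1..M} - {m}. blinfun_apply (l k) v = 0)"
    by (rule ex_nonzero_common_kernel[OF _ _ assms(1)])
       (use m in \<open>auto intro: bounded_linear.linear blinfun.bounded_linear_right\<close>)
  then obtain v where v: "v \<in> V" "v \<noteq> 0" "\<forall>k\<in>{1..M} - {m}. blinfun_apply (l k) v = 0" by blast
  then have "blinfun_apply (l m) v \<noteq> 0"
    using assms(2) unfolding unisolvent_def by (metis DiffI singletonD)
  then show "\<exists>w. w \<in> V \<and> (\<forall>k\<in>{1..M}. blinfun_apply (l k) w = (if k = m then 1 else 0))"
    using v V
    by (intro exI[of _ "inverse (blinfun_apply (l m) v) *\<^sub>R v"])
       (auto simp: subspace_scale blinfun.bilinear_simps)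
qed

text \<open>The dual basis gives an explicit finite sum \<open>P\<close> with the right
  observations, and unisolvency makes it the only such element of \<open>V\<close>. Boundedness is
  read off the sum.\<close>

lemma
  fixes l :: "nat \<Rightarrow> 'a::real_inner \<Rightarrow>\<^sub>L real"
  assumes "finite_dim_subspace M V" "unisolvent l M V"
  shows bounded_linear_interp: "bounded_linear (interp l M V)"
    and interp_in: "interp l M V u \<in> V"
    and apply_interp: "m \<in> {1..M} \<Longrightarrow> blinfun_apply (l m) (interp l M V u) = blinfun_apply (l m) u"
    and interp_eqI: "w \<in> V \<Longrightarrow> (\<And>m. m \<in> {1..M} \<Longrightarrow> blinfun_apply (l m) w = blinfun_apply (l m) u)
      \<Longrightarrow> interp l M V u = w"
proof -
  have V: "subspace V" using assms(1) unfolding finite_dim_subspace_def by auto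
  obtain \<psi> where \<psi>: "\<And>m. m \<in> {1..M} \<Longrightarrow> \<psi> m \<in> V"
    "\<And>m k. m \<in> {1..M} \<Longrightarrow> k \<in> {1..M} \<Longrightarrow> blinfun_apply (l k) (\<psi> m) = (if k = m then 1 else 0)"
    using ex_dual_basis[OF assms] by blast
  define P where "P u = (\<Sum>m\<in>{1..M}. blinfun_apply (l m) u *\<^sub>R \<psi> m)" for u
  have P_in: "P u \<in> V" for u
    unfolding P_def using \<psi>(1) V by (intro subspace_sum subspace_scale) auto
  have l_P: "blinfun_apply (l k) (P u) = blinfun_apply (l k) u" if "k \<in> {1..M}" for k u
  proof -
    have "blinfun_apply (l k) (P u) = (\<Sum>m\<in>{1..M}. blinfun_apply (l m) u * (if k = m then 1 else 0))"
      unfolding P_def blinfun.sum_right blinfun.scaleR_right using \<psi>(2) that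
      by (intro sum.cong) auto
    also have "\<dots> = (\<Sum>m\<in>{1..M}. if k = m then blinfun_apply (l m) u else 0)"
      by (intro sum.cong) auto
    finally show ?thesis using that by simp
  qed
  have uniq: "w = P u"
    if "w \<in> V" "\<And>m. m \<in> {1..M} \<Longrightarrow> blinfun_apply (l m) w = blinfun_apply (l m) u" for w u
  proof -
    have "w - P u \<in> V" using that(1) P_in V by (simp add: subspace_diff)
    moreover have "\<forall>m\<in>{1..M}. blinfun_apply (l m) (w - P u) = 0"
      using that(2) l_P by (simp add: blinfun.bilinear_simps)
    ultimately have "w - P u = 0" using assms(2) unfolding unisolvent_def by blast
    then show ?thesis by simp
  qed
  have P_eq: "interp l M V u = P u" for u
    unfolding interp_def by (rule the_equality) (use P_in l_P uniq in auto)
  show "interp l M V u \<in> V" "m \<in> {1..M} \<Longrightarrow> blinfun_apply (l m) (interp l M V u) = blinfun_apply (l m) u"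
    using P_in l_P by (simp_all add: P_eq)
  show "interp l M V u = w"
    if "w \<in> V" "\<And>m. m \<in> {1..M} \<Longrightarrow> blinfun_apply (l m) w = blinfun_apply (l m) u"
    using uniq[OF that] by (simp add: P_eq)
  have "bounded_linear P"
    unfolding P_def
    by (intro bounded_linear_sum bounded_linear_scaleR_const blinfun.bounded_linear_right)
  moreover have "interp l M V = P" using P_eq by blast
  ultimately show "bounded_linear (interp l M V)" by simp
qed

section \<open>The modified norm and the inf-sup constant\<close>

lemma tnorm_sq: "(tnorm I u)\<^sup>2 = (norm (u - I u))\<^sup>2 + (norm (I u))\<^sup>2"
  by (simp add: tnorm_def tinner_def power2_norm_eq_inner)

lemma tnorm_nonneg: "0 \<le> tnorm I u"
  by (simp add: tnorm_def tinner_def)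

lemma norm_le_tnorm: "norm (I u) \<le> tnorm I u"
  by (rule power2_le_imp_le) (simp_all add: tnorm_sq tnorm_nonneg)

text \<open>For \<open>q\<close> fixed by \<open>I\<close>, \<open>tinner I z q\<close> is
  \<open>I z \<bullet> q\<close> and \<open>tnorm I q\<close> is \<open>norm q\<close>, so
  Cauchy-Schwarz bounds every quotient. The rest secures the boundedness that real
  \<open>SUP\<close> and \<open>INF\<close> require.\<close>

lemma infsup_le:
  assumes "I 0 = 0" "\<And>q. q \<in> U \<Longrightarrow> I q = q" "U - {0} \<noteq> {}" "z \<in> Z" "z \<noteq> 0"
  shows "infsup I Z U \<le> norm (I z) / tnorm I z"
proof -
  define f where "f z q = tinner I z q / (tnorm I z * tnorm I q)" for z q
  have f: "\<bar>f z q\<bar> \<le> norm (I z) / tnorm I z" if "q \<in> U - {0}" for z q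
  proof -
    have q: "I q = q" using that assms(2) by blast
    then have "(tnorm I q)\<^sup>2 = (norm q)\<^sup>2" by (simp add: tnorm_sq)
    then have "tnorm I q = norm q" using tnorm_nonneg by (metis norm_ge_zero power2_eq_imp_eq)
    then have "\<bar>f z q\<bar> = \<bar>I z \<bullet> q\<bar> / (tnorm I z * norm q)"
      using q tnorm_nonneg[of I z] by (simp add: f_def tinner_def abs_mult)
    also have "\<dots> \<le> (norm (I z) * norm q) / (tnorm I z * norm q)"
      by (intro divide_right_mono Cauchy_Schwarz_ineq2) (simp add: tnorm_nonneg)
    also have "\<dots> = norm (I z) / tnorm I z" using that by simp
    finally show ?thesis .
  qed
  have le1: "norm (I z) / tnorm I z \<le> 1" for z
    using norm_le_tnorm[of I z] tnorm_nonneg[of I z] by (cases "tnorm I z = 0") auto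
  have bdd: "bdd_above (f z ` (U - {0}))" for z
    by (rule bdd_aboveI[of _ "norm (I z) / tnorm I z"]) (use f in \<open>auto simp: abs_le_iff\<close>)
  obtain q where q: "q \<in> U - {0}" using assms(3) by blast
  \<comment> \<open>A lower bound uniform in \<open>z\<close>, so that the outer \<open>INF\<close>
    is a genuine infimum.\<close>
  have "-1 \<le> (SUP q\<in>U - {0}. f z q)" for z
  proof -
    have "-1 \<le> f z q" using f[OF q, of z] le1[of z] by linarith
    also have "\<dots> \<le> (SUP q\<in>U - {0}. f z q)" by (rule cSUP_upper[OF q bdd])
    finally show ?thesis .
  qed
  then have "bdd_below ((\<lambda>z. SUP q\<in>U - {0}. f z q) ` (Z - {0}))" by (auto intro!: bdd_belowI)
  then have "(INF z\<in>Z - {0}. SUP q\<in>U - {0}. f z q) \<le> (SUP q\<in>U - {0}. f z q)"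
    using assms(4,5) by (intro cINF_lower) auto
  also have "\<dots> \<le> norm (I z) / tnorm I z"
    using assms(3) f[of _ z] by (intro cSUP_least) (auto simp: abs_le_iff)
  finally show ?thesis by (simp add: infsup_def f_def)
qed

text \<open>A weighted Cauchy-Schwarz inequality in which \<beta> acts as the cosine of an angle and
  \<open>s\<close> below as its squared sine. Here \<open>a\<close> and \<open>b\<close> will be the
  lengths of the components of an element of \<open>Z\<close> in \<open>UM\<close> and in the kernel
  of \<open>I\<close>.\<close>

lemma scaled_sum_le_if_angle:
  fixes a b c \<beta> :: real
  assumes "0 < \<beta>" "\<beta> \<le> 1" "\<beta>\<^sup>2 * (a\<^sup>2 + b\<^sup>2) \<le> a\<^sup>2"
  shows "\<beta>\<^sup>2 * (c + b)\<^sup>2 \<le> c\<^sup>2 + a\<^sup>2"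
\<comment> \<open>For \<beta> equal to 1 the hypothesis forces \<open>b = 0\<close>; otherwise
  \<open>s\<close> is positive and can be cancelled at the end.\<close>
proof (cases "\<beta> = 1")
  case True
  then show ?thesis using assms(3) by simp
next
  case False
  define s where "s = 1 - \<beta>\<^sup>2"
  have \<beta>2: "\<beta>\<^sup>2 = 1 - s" by (simp add: s_def)
  have "\<beta>\<^sup>2 < 1" using False assms by (simp add: power2_less_1_iff)
  then have s: "0 < s" by (simp add: s_def)
  have "(1 - s) * b\<^sup>2 \<le> s * a\<^sup>2" using assms(3) unfolding \<beta>2 by (simp add: algebra_simps)
  \<comment> \<open>Subtracting this square from
    \<open>s * (c\<^sup>2 + a\<^sup>2 - (1 - s) * (c + b)\<^sup>2)\<close> leaves
    \<open>s * a\<^sup>2 - (1 - s) * b\<^sup>2\<close>, nonnegative by the previous fact.\<close>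
  moreover have "0 \<le> (s * c - (1 - s) * b)\<^sup>2" by simp
  ultimately have "0 \<le> s * (c\<^sup>2 + a\<^sup>2 - (1 - s) * (c + b)\<^sup>2)"
    by (simp add: power2_eq_square algebra_simps)
  then show ?thesis using s unfolding \<beta>2 by (simp add: zero_le_mult_iff)
qed

section \<open>Optimality conditions\<close>

text \<open>Two competitors are used. In the variational case, interpolating the update keeps the
  observations and shortens it unless it already lies in \<open>UM\<close>. Then trading
  \<open>t *\<^sub>R z'\<close> in the background for \<open>t *\<^sub>R I z'\<close> in the update
  also keeps them, and the first variation in \<open>t\<close> gives orthogonality.\<close>

lemma optimal_update_in_tperp:
  fixes l :: "nat \<Rightarrow> 'a::{real_inner,complete_space} \<Rightarrow>\<^sub>L real"
  assumes "subspace Z" "finite_dim_subspace M UM" "unisolvent l M UM"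
    and U: "U = UM \<or> (U = UNIV \<and> UM = span ((\<lambda>m. riesz (l m)) ` {1..M}))"
    and "I = interp l M UM"
    and opt: "is_arg_min (\<lambda>(z, \<eta>). norm \<eta>) (feasible l M y Z U) (z, \<eta>)"
  shows "\<eta> \<in> UM \<inter> tperp I Z"
proof -
  have UM: "subspace UM" using assms(2) unfolding finite_dim_subspace_def by auto
  note I_in = interp_in[OF assms(2,3), folded assms(5)]
  note l_I = apply_interp[OF assms(2,3), folded assms(5)]
  note I_eqI = interp_eqI[OF assms(2,3), folded assms(5)]
  have feas: "z \<in> Z" "\<eta> \<in> U" "\<And>m. m \<in> {1..M} \<Longrightarrow> blinfun_apply (l m) (z + \<eta>) = y m"
    using opt by (auto simp: is_arg_min_def feasible_def)
  have min: "norm \<eta> \<le> norm \<eta>'"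
    if "z' \<in> Z" "\<eta>' \<in> U" "\<And>m. m \<in> {1..M} \<Longrightarrow> blinfun_apply (l m) (z' + \<eta>') = y m" for z' \<eta>'
  proof -
    have "feasible l M y Z U (z', \<eta>')" using that by (simp add: feasible_def)
    then show ?thesis using opt by (auto simp: is_arg_min_def not_less)
  qed
  have \<eta>_UM: "\<eta> \<in> UM"
    using U
  proof
    assume "U = UM" then show ?thesis using feas by simp
  next
    assume "U = UNIV \<and> UM = span ((\<lambda>m. riesz (l m)) ` {1..M})"
    then have U': "U = UNIV" and span: "UM = span ((\<lambda>m. riesz (l m)) ` {1..M})" by auto
    \<comment> \<open>\<open>I\<close> preserves observations, so the interpolation defect is
      orthogonal to every Riesz representer.\<close>
    have "orthogonal (\<eta> - I \<eta>) (I \<eta>)"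
    proof (rule orthogonal_to_span)
      show "I \<eta> \<in> span ((\<lambda>m. riesz (l m)) ` {1..M})" using I_in span by simp
      fix r assume "r \<in> (\<lambda>m. riesz (l m)) ` {1..M}"
      then show "orthogonal (\<eta> - I \<eta>) r"
        using l_I by (auto simp: orthogonal_def inner_commute[of "\<eta> - I \<eta>"] riesz_inner blinfun.bilinear_simps)
    qed
    then have "(norm ((\<eta> - I \<eta>) + I \<eta>))\<^sup>2 = (norm (\<eta> - I \<eta>))\<^sup>2 + (norm (I \<eta>))\<^sup>2"
      by (rule norm_add_Pythagorean)
    moreover have "norm \<eta> \<le> norm (I \<eta>)"
      using min[of z "I \<eta>"] feas l_I U' by (simp add: blinfun.bilinear_simps)
    then have "(norm \<eta>)\<^sup>2 \<le> (norm (I \<eta>))\<^sup>2" by simp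
    ultimately have "(norm (\<eta> - I \<eta>))\<^sup>2 \<le> 0" by simp
    then show ?thesis using I_in[of \<eta>] by simp
  qed
  moreover have "\<eta> \<bullet> I z' = 0" if "z' \<in> Z" for z'
  proof (rule linear_coeff_eq_0_if_quadratic_nonneg)
    fix t :: real
    have "\<eta> + t *\<^sub>R I z' \<in> UM" using \<eta>_UM I_in UM by (simp add: subspace_add subspace_scale)
    then have "\<eta> + t *\<^sub>R I z' \<in> U" using U by blast
    moreover have "z - t *\<^sub>R z' \<in> Z" using feas that assms(1) by (simp add: subspace_diff subspace_scale)
    ultimately have "norm \<eta> \<le> norm (\<eta> + t *\<^sub>R I z')"
      using min[of "z - t *\<^sub>R z'" "\<eta> + t *\<^sub>R I z'"] feas(3) l_I by (simp add: blinfun.bilinear_simps)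
    then have "\<eta> \<bullet> \<eta> \<le> (\<eta> + t *\<^sub>R I z') \<bullet> (\<eta> + t *\<^sub>R I z')" by (simp add: norm_le)
    then show "0 \<le> t\<^sup>2 * (I z' \<bullet> I z') + 2 * t * (\<eta> \<bullet> I z')"
      by (simp add: inner_add_left inner_add_right inner_commute power2_eq_square algebra_simps)
  qed
  \<comment> \<open>As \<open>I\<close> fixes \<open>\<eta>\<close>,
    \<open>tinner I \<eta> z'\<close> reduces to \<open>\<eta> \<bullet> I z'\<close>.\<close>
  ultimately show ?thesis
    using I_eqI[of \<eta> \<eta>] by (auto simp: tperp_def tinner_def)
qed

section \<open>Error bounds\<close>

theorem proposition3p1:
  fixes l :: "nat \<Rightarrow> 'a::{real_inner,complete_space} \<Rightarrow>\<^sub>L real"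
    and N M :: nat
    and Z UM U :: "'a set"
    and y :: "nat \<Rightarrow> real"
    and I :: "'a \<Rightarrow> 'a"
    and utrue zopt \<eta>opt uopt :: 'a
    and \<beta> :: real
  assumes "1 \<le> N" and "1 \<le> M"
    and "finite_dim_subspace N Z"
    and "finite_dim_subspace M UM"
    and "U = UM \<or> (U = UNIV \<and> UM = span ((\<lambda>m. riesz (l m)) ` {1..M}))"
    and "\<forall>m\<in>{1..M}. y m = blinfun_apply (l m) utrue"
    and "unisolvent l M UM"
    and "I = interp l M UM"
    and "\<beta> = infsup I Z UM"
    and "\<beta> > 0"
    and "is_arg_min (\<lambda>(z, \<eta>). norm \<eta>) (feasible l M y Z U) (zopt, \<eta>opt)"
    and "uopt = zopt + \<eta>opt"
  shows "tnorm I (utrue - uopt)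
           \<le> 1 / \<beta> * (INF z\<in>Z. INF q\<in>UM \<inter> tperp I Z. tnorm I (utrue - z - q))
       \<and> norm (utrue - uopt)
           \<le> sqrt (4 + 6 * (onorm I)\<^sup>2) / \<beta>
               * (INF z\<in>Z. INF q\<in>UM \<inter> tperp I Z. norm (utrue - z - q))"
proof -
  have Z: "subspace Z" and UM: "subspace UM"
    using assms(3,4) unfolding finite_dim_subspace_def by auto
  note bl = bounded_linear_interp[OF assms(4,7), folded assms(8)]
  interpret I: bounded_linear I by (rule bl)
  note I_eqI = interp_eqI[OF assms(4,7), folded assms(8)]
  have I_id: "I q = q" if "q \<in> UM" for q using I_eqI[of q q] that by simp
  have ex_nz: "V - {0} \<noteq> {}" if "1 \<le> n" "finite_dim_subspace n V" for n and V :: "'a set"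
    using ex_nonzero_common_kernel[of "{}" "\<lambda>_ _. 0" n V] that by auto
  have angle: "\<beta> * tnorm I z \<le> norm (I z)" if "z \<in> Z" for z
  proof (cases "tnorm I z = 0")
    case False
    then have "z \<noteq> 0" by (auto simp: tnorm_def tinner_def I.zero)
    then have "\<beta> \<le> norm (I z) / tnorm I z"
      using infsup_le[of I UM z Z] I.zero I_id ex_nz[OF assms(2,4)] that assms(9) by simp
    then show ?thesis using False tnorm_nonneg[of I z] by (simp add: field_simps)
  qed simp
  \<comment> \<open>A nonzero \<open>z\<close> is essential here: an \<open>INF\<close> over an
    empty set would carry no information about \<beta>.\<close>
  have \<beta>_le: "\<beta> \<le> 1"
  proof -
    obtain z where z: "z \<in> Z" "z \<noteq> 0" using ex_nz[OF assms(1,3)] by blast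
    then have "\<beta> \<le> norm (I z) / tnorm I z"
      using infsup_le[of I UM z Z] I.zero I_id ex_nz[OF assms(2,4)] assms(9) by simp
    also have "\<dots> \<le> 1"
      using norm_le_tnorm[of I z] tnorm_nonneg[of I z] by (cases "tnorm I z = 0") auto
    finally show ?thesis .
  qed
  define e where "e = utrue - uopt"
  have \<eta>: "\<eta>opt \<in> UM" "\<eta>opt \<in> tperp I Z" and zopt: "zopt \<in> Z"
    using optimal_update_in_tperp[OF Z assms(4,7,5,8,11)] assms(11)
    by (auto simp: is_arg_min_def feasible_def)
  \<comment> \<open>\<open>utrue\<close> and \<open>uopt\<close> have the same observations, so 0
    interpolates \<open>e\<close>.\<close>
  have Ie: "I e = 0"
    by (rule I_eqI)
      (use assms(6,11) UM in \<open>auto simp: e_def assms(12) is_arg_min_def feasible_def blinfun.bilinear_simps subspace_0\<close>)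
  have key: "\<beta> * tnorm I e \<le> tnorm I (utrue - z - q)" if z: "z \<in> Z" and q: "q \<in> UM \<inter> tperp I Z" for z q
  proof (rule power2_le_imp_le)
    define \<zeta> where "\<zeta> = zopt - z"
    define \<delta> where "\<delta> = \<eta>opt - q"
    have \<zeta>: "\<zeta> \<in> Z" using z zopt Z by (simp add: \<zeta>_def subspace_diff)
    have I\<delta>: "I \<delta> = \<delta>" using q \<eta> by (simp add: \<delta>_def I.diff I_id)
    have orth: "\<delta> \<bullet> I \<zeta> = 0"
    proof -
      have "tinner I \<eta>opt \<zeta> = 0" "tinner I q \<zeta> = 0" using \<eta> q \<zeta> by (auto simp: tperp_def)
      then show ?thesis using q \<eta> by (simp add: \<delta>_def tinner_def I_id inner_diff_left)
    qed
    define w where "w = utrue - z - q"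
    have w: "w = e + \<zeta> + \<delta>" by (simp add: w_def e_def \<zeta>_def \<delta>_def assms(12))
    have Iw: "I w = I \<zeta> + \<delta>" by (simp add: w I.add Ie I\<delta>)
    \<comment> \<open>Since \<open>I e = 0\<close> and \<open>I \<delta> = \<delta>\<close>,
      \<open>c\<close> measures the component of \<open>w\<close> in the kernel of \<open>I\<close>;
      \<open>a\<close> and \<open>b\<close> measure the two components of
      \<open>\<zeta>\<close>.\<close>
    define a b c where "a = norm (I \<zeta>)" and "b = norm (\<zeta> - I \<zeta>)" and "c = norm (e + \<zeta> - I \<zeta>)"
    have "(tnorm I w)\<^sup>2 = c\<^sup>2 + (norm (I \<zeta> + \<delta>))\<^sup>2"
      by (simp add: tnorm_sq Iw) (simp add: w c_def algebra_simps)
    also have "(norm (I \<zeta> + \<delta>))\<^sup>2 = a\<^sup>2 + (norm \<delta>)\<^sup>2"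
      unfolding a_def by (rule norm_add_Pythagorean) (simp add: orthogonal_def inner_commute orth)
    finally have w_ge: "c\<^sup>2 + a\<^sup>2 \<le> (tnorm I w)\<^sup>2" by simp
    have "(\<beta> * tnorm I \<zeta>)\<^sup>2 \<le> (norm (I \<zeta>))\<^sup>2"
      using angle[OF \<zeta>] assms(10) tnorm_nonneg[of I \<zeta>] by (intro power_mono) auto
    then have "\<beta>\<^sup>2 * (a\<^sup>2 + b\<^sup>2) \<le> a\<^sup>2"
      by (simp add: power_mult_distrib tnorm_sq a_def b_def add.commute)
    then have "\<beta>\<^sup>2 * (c + b)\<^sup>2 \<le> c\<^sup>2 + a\<^sup>2"
      by (rule scaled_sum_le_if_angle[OF assms(10) \<beta>_le])
    \<comment> \<open>\<open>e\<close> is the difference of the two kernel components measured by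
      \<open>c\<close> and \<open>b\<close>.\<close>
    moreover have "norm e \<le> c + b"
      using norm_triangle_ineq4[of "e + \<zeta> - I \<zeta>" "\<zeta> - I \<zeta>"] by (simp add: b_def c_def)
    then have "\<beta>\<^sup>2 * (norm e)\<^sup>2 \<le> \<beta>\<^sup>2 * (c + b)\<^sup>2"
      by (intro mult_left_mono power_mono) auto
    ultimately show "(\<beta> * tnorm I e)\<^sup>2 \<le> (tnorm I (utrue - z - q))\<^sup>2"
      using w_ge by (simp add: power_mult_distrib tnorm_sq[of I e] Ie w_def)
  qed (rule tnorm_nonneg)
  \<comment> \<open>The optimal pair itself shows that both infima range over nonempty sets.\<close>
  have ne: "Z \<noteq> {}" "UM \<inter> tperp I Z \<noteq> {}" using \<eta> zopt by auto
  have "\<beta> * tnorm I e \<le> (INF z\<in>Z. INF q\<in>UM \<inter> tperp I Z. tnorm I (utrue - z - q))"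
    using key ne by (intro cINF_greatest) auto
  then have first: "tnorm I e \<le> 1 / \<beta> * (INF z\<in>Z. INF q\<in>UM \<inter> tperp I Z. tnorm I (utrue - z - q))"
    using assms(10) by (simp add: field_simps)
  define C where "C = sqrt (4 + 6 * (onorm I)\<^sup>2)"
  have C: "0 < C" by (simp add: C_def add_pos_nonneg)
  have tnorm_le: "tnorm I w \<le> C * norm w" for w
  proof (rule power2_le_imp_le)
    have Iw: "(norm (I w))\<^sup>2 \<le> (onorm I)\<^sup>2 * (norm w)\<^sup>2"
      using power_mono[OF onorm[OF bl, of w], of 2] by (simp add: power_mult_distrib)
    have "(norm (w - I w))\<^sup>2 \<le> (norm w + norm (I w))\<^sup>2"
      by (intro power_mono norm_triangle_ineq4) simp
    also have "\<dots> \<le> 2 * (norm w)\<^sup>2 + 2 * (norm (I w))\<^sup>2"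
      using sum_squares_bound[of "norm w" "norm (I w)"] by (simp add: power2_sum)
    finally have "(tnorm I w)\<^sup>2 \<le> 2 * (norm w)\<^sup>2 + 3 * (norm (I w))\<^sup>2" by (simp add: tnorm_sq)
    \<comment> \<open>The triangle inequality gives the coefficients 2 and 3; doubling them reaches
      the stated constant.\<close>
    also have "\<dots> \<le> 4 * (norm w)\<^sup>2 + 6 * ((onorm I)\<^sup>2 * (norm w)\<^sup>2)"
      using Iw zero_le_power2[of "norm w"] zero_le_power2[of "norm (I w)"] by linarith
    also have "\<dots> = (C * norm w)\<^sup>2" by (simp add: C_def power_mult_distrib algebra_simps)
    finally show "(tnorm I w)\<^sup>2 \<le> (C * norm w)\<^sup>2" .
  qed (use C in simp)
  \<comment> \<open>The error lies in the kernel of \<open>I\<close>, so the constant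
    \<open>C\<close> is paid only for the residual.\<close>
  have e_norm: "tnorm I e = norm e"
    using tnorm_sq[of I e] Ie tnorm_nonneg[of I e] by (auto intro: power2_eq_imp_eq)
  have "\<beta> * norm e / C \<le> norm (utrue - z - q)" if "z \<in> Z" "q \<in> UM \<inter> tperp I Z" for z q
    using key[OF that] tnorm_le[of "utrue - z - q"] C by (simp add: e_norm field_simps)
  then have "\<beta> * norm e / C \<le> (INF z\<in>Z. INF q\<in>UM \<inter> tperp I Z. norm (utrue - z - q))"
    using ne by (intro cINF_greatest) auto
  then have "norm e \<le> C / \<beta> * (INF z\<in>Z. INF q\<in>UM \<inter> tperp I Z. norm (utrue - z - q))"
    using assms(10) C by (simp add: field_simps)
  with first show ?thesis by (simp only: e_def C_def)
qed

end
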